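(* Let $\{\mathbf{W}_j\}_{j\in T_2}\subset\ell^2(\Lambda,\mathbb{C}^S)$ be such that $\mathcal{G}(\Lambda,T_1,T_2,\mathbf{W}_j)$ is a DVNUG frame for $\ell^2(\Lambda,\mathbb{C}^S)$ with (lower and upper) frame bounds $A_0$ and $B_0$. Then $\mathcal{G}(\Lambda,T_1,T_2,\mu_{\mathbf{W}_j})$ is a DVNUG frame for $\ell^2(\Lambda,\mathbb{C})$ with (lower and upper) frame bounds $\frac{A_0}{S}$ and $\frac{B_0}{S}$, where $\mu_{\mathbf{W}_j}\in\ell^2(\Lambda,\mathbb{C})$ is the arithmetic mean sequence of $\mathbf{W}_j$.
   Context: Standing setting: $N,M,S\in\mathbb{N}$ (positive integers), $P\in\mathbb{N}\cup\{0\}$, $r$ is an odd integer coprime with $N$ with $1\le r\le 2N-1$, $\Lambda=\{0,\frac{r}{N}\}+2\mathbb{Z}$, $T_1=\{0,1,\dots,M-1\}$, $T_2=\{0,1,\dots,P\}$. For $\mathbf{X}\in\mathbb{C}^S$, $[\mathbf{X}]_k$ is its $k$-th coordinate. $\ell^2(\Lambda,\mathbb{C}^S)$ is the Hilbert space of families $\mathbf{Z}=\{\mathbf{Z}(\lambda)\}_{\lambda\in\Lambda}\subset\mathbb{C}^S$ with $\sum_{\lambda\in\Lambda}\sum_{k=1}^S|[\mathbf{Z}(\lambda)]_k|^2<\infty$, with inner product $\langle\mathbf{Z},\mathbf{W}\rangle=\sum_{\lambda\in\Lambda}\sum_{k=1}^S[\mathbf{Z}(\lambda)]_k\overline{[\mathbf{W}(\lambda)]_k}$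 and induced norm $\|\cdot\|_{\ell^2}$; $\ell^2(\Lambda,\mathbb{C})$ is the case $S=1$. Arithmetic mean sequence: for $\mathbf{Z}\in\ell^2(\Lambda,\mathbb{C}^S)$, $\mu_{\mathbf{Z}}=\{\mu_{\mathbf{Z}}(\lambda)\}_{\lambda\in\Lambda}\in\ell^2(\Lambda,\mathbb{C})$ with $\mu_{\mathbf{Z}}(\lambda)=\frac1S\sum_{k=1}^S[\mathbf{Z}(\lambda)]_k$. Operators on $\ell^2(\Lambda,\mathbb{C}^S)$ (for every $S$, including $S=1$): for $\lambda\in\Lambda$, $(R_{2N\lambda}\mathbf{Z})(\lambda')=\mathbf{Z}(\lambda'-2N\lambda)$, $\lambda'\in\Lambda$ (well defined since $2N\Lambda\subset 2\mathbb{Z}$); for $m\in T_1$, $(E_{\frac mM}\mathbf{Z})(\lambda')=e^{2\pi i\frac mM\lambda'}\mathbf{Z}(\lambda')$, $\lambda'\in\Lambda$. $\mathcal{G}(\Lambda,T_1,T_2,\mathbf{W}_j)$ denotes the collection $\{E_{\frac mM}R_{2N\lambda}\mathbf{W}_j:\lambda\in\Lambda,\,m\in T_1,\,j\in T_2\}$ (the discrete vector-valued nonuniform Gabor system, DVNUG system, with window sequences $\mathbf{W}_j$). It is a DVNUG frame for $\ell^2(\Lambda,\mathbb{C}^S)$ with lower and upper frame bounds $\alpha,\beta$ ($0<\alpha\le\beta<\infty$) if $\alpha\|\mathbf{Z}\|_{\ell^2}^2\le\sum_{m\in T_1,\,j\in T_2,\,\lambda\in\Lambda}|\langle\mathbf{Z},E_{\frac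 mM}R_{2N\lambda}\mathbf{W}_j\rangle|^2\le\beta\|\mathbf{Z}\|_{\ell^2}^2$ for all $\mathbf{Z}\in\ell^2(\Lambda,\mathbb{C}^S)$. The same definitions with $S=1$ apply to windows in $\ell^2(\Lambda,\mathbb{C})$. *)

theory Defs
  imports "HOL-Analysis.Analysis"
begin

text \<open>The space \<open>C\<^sup>S\<close> is \<open>complex ^ 's\<close> with \<open>S = CARD('s)\<close>; the scalar case \<open>S = 1\<close> is \<open>complex ^ 1\<close>.
  A family indexed by \<open>\<Lambda>\<close> is a total function on the reals of which only the values on \<open>\<Lambda>\<close>
  matter: all notions below evaluate families on \<open>\<Lambda>\<close> only.\<close>

definition Lam :: "nat \<Rightarrow> int \<Rightarrow> real set" where
  "Lam N r = {a + 2 * of_int n | a n. a \<in> {0, of_int r / of_nat N}}"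

definition l2 :: "real set \<Rightarrow> (real \<Rightarrow> complex ^ 's) set" where
  "l2 \<Lambda> = {Z. (\<lambda>x. \<Sum>k\<in>UNIV. (cmod (Z x $ k))\<^sup>2) summable_on \<Lambda>}"

definition l2_inner :: "real set \<Rightarrow> (real \<Rightarrow> complex ^ 's) \<Rightarrow> (real \<Rightarrow> complex ^ 's) \<Rightarrow> complex" where
  "l2_inner \<Lambda> Z W = (\<Sum>\<^sub>\<infinity>x\<in>\<Lambda>. \<Sum>k\<in>UNIV. Z x $ k * cnj (W x $ k))"

definition l2_norm :: "real set \<Rightarrow> (real \<Rightarrow> complex ^ 's) \<Rightarrow> real" where
  "l2_norm \<Lambda> Z = sqrt (Re (l2_inner \<Lambda> Z Z))"

definition arith_mean :: "(real \<Rightarrow> complex ^ 's) \<Rightarrow> real \<Rightarrow> complex ^ 1" where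
  "arith_mean Z = (\<lambda>x. \<chi> i. 1 / of_nat CARD('s) * (\<Sum>k\<in>UNIV. Z x $ k))"

text \<open>\<open>shift_op N l\<close> is the operator with subscript \<open>2 N l\<close>. It is well defined on families indexed
  by \<open>\<Lambda>\<close> because \<open>2 N l\<close> is an even integer for \<open>l\<close> in \<open>\<Lambda>\<close>.\<close>

definition shift_op :: "nat \<Rightarrow> real \<Rightarrow> (real \<Rightarrow> complex ^ 's) \<Rightarrow> real \<Rightarrow> complex ^ 's" where
  "shift_op N l Z = (\<lambda>x. Z (x - 2 * of_nat N * l))"

definition mod_op :: "nat \<Rightarrow> nat \<Rightarrow> (real \<Rightarrow> complex ^ 's) \<Rightarrow> real \<Rightarrow> complex ^ 's" where
  "mod_op M m Z = (\<lambda>x. exp (2 * of_real pi * \<i> * (of_nat m / of_nat M) * of_real x) *s Z x)"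

definition dvnug :: "nat \<Rightarrow> nat \<Rightarrow> (nat \<Rightarrow> real \<Rightarrow> complex ^ 's) \<Rightarrow> nat \<times> nat \<times> real \<Rightarrow> real \<Rightarrow> complex ^ 's" where
  "dvnug N M W = (\<lambda>(m, j, l). mod_op M m (shift_op N l (W j)))"

text \<open>Summability is required explicitly, since \<open>infsum\<close> of a divergent series is \<open>0\<close>.\<close>

definition dvnug_frame ::
    "nat \<Rightarrow> int \<Rightarrow> nat \<Rightarrow> nat \<Rightarrow> (nat \<Rightarrow> real \<Rightarrow> complex ^ 's) \<Rightarrow> real \<Rightarrow> real \<Rightarrow> bool" where
  "dvnug_frame N r M P W \<alpha> \<beta> \<longleftrightarrow>
     (let \<Lambda> = Lam N r; I = {0..<M} \<times> {0..P} \<times> \<Lambda> in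
      0 < \<alpha> \<and> \<alpha> \<le> \<beta> \<and>
      (\<forall>Z \<in> l2 \<Lambda>.
         (\<lambda>i. (cmod (l2_inner \<Lambda> Z (dvnug N M W i)))\<^sup>2) summable_on I \<and>
         \<alpha> * (l2_norm \<Lambda> Z)\<^sup>2 \<le> (\<Sum>\<^sub>\<infinity>i\<in>I. (cmod (l2_inner \<Lambda> Z (dvnug N M W i)))\<^sup>2) \<and>
         (\<Sum>\<^sub>\<infinity>i\<in>I. (cmod (l2_inner \<Lambda> Z (dvnug N M W i)))\<^sup>2) \<le> \<beta> * (l2_norm \<Lambda> Z)\<^sup>2))"

end

theory Submission
  imports Defs
begin

text \<open>The map \<open>spread\<close> is the adjoint of \<open>arith_mean\<close>. It scales squared norms by \<open>1 / S\<close>, and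
  modulations and shifts commute with \<open>arith_mean\<close>, so the frame inequalities for \<open>z\<close> and the averaged
  windows are those for \<open>spread z\<close> and the original windows.\<close>

definition spread :: "(real \<Rightarrow> complex ^ 1) \<Rightarrow> real \<Rightarrow> complex ^ 's" where
  "spread z = (\<lambda>x. \<chi> k. z x $ 1 / of_nat CARD('s))"

text \<open>Cauchy-Schwarz at each point dominates the squared modulus of the mean by the sum of the
  squared coordinates; comparison then gives summability.\<close>

lemma arith_mean_in_l2:
  fixes Z :: "real \<Rightarrow> complex ^ 's"
  assumes "Z \<in> l2 \<Lambda>"
  shows "arith_mean Z \<in> l2 \<Lambda>"
proof -
  have "(cmod (arith_mean Z x $ 1))\<^sup>2 \<le> (\<Sum>k\<in>UNIV. (cmod (Z x $ k))\<^sup>2)" for x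
  proof -
    have "cmod (\<Sum>k\<in>UNIV. Z x $ k) \<le> (\<Sum>k\<in>UNIV. cmod (Z x $ k))"
      by (rule norm_sum)
    then have "(cmod (\<Sum>k\<in>UNIV. Z x $ k))\<^sup>2 \<le> (\<Sum>k\<in>UNIV. cmod (Z x $ k))\<^sup>2"
      by (rule power_mono) simp
    also have "\<dots> \<le> real CARD('s) * (\<Sum>k\<in>UNIV. (cmod (Z x $ k))\<^sup>2)"
      using sum_squared_le_sum_of_squares[of "\<lambda>k. cmod (Z x $ k)" UNIV] by (simp add: mult.commute)
    \<comment> \<open>The crude bound \<open>S <= S^2\<close> suffices: it cancels the factor
      \<open>1 / S^2\<close> of the squared mean and leaves the constant 1.\<close>
    also have "\<dots> \<le> (real CARD('s))\<^sup>2 * (\<Sum>k\<in>UNIV. (cmod (Z x $ k))\<^sup>2)"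
      by (intro mult_right_mono sum_nonneg) (auto simp: power2_eq_square)
    finally show ?thesis
      by (simp add: arith_mean_def norm_divide power_divide divide_le_eq mult.commute)
  qed
  then show ?thesis
    using assms unfolding l2_def
    by (auto intro: summable_on_comparison_test)
qed

lemma spread_in_l2:
  assumes "z \<in> l2 \<Lambda>"
  shows "(spread z :: real \<Rightarrow> complex ^ 's) \<in> l2 \<Lambda>"
proof -
  \<comment> \<open>There are \<open>S\<close> equal coordinates, each contributing
    \<open>1 / S^2\<close> times the squared modulus of \<open>z x $ 1\<close>.\<close>
  have "(\<lambda>x. real CARD('s) / (real CARD('s))\<^sup>2 * (cmod (z x $ 1))\<^sup>2) summable_on \<Lambda>"
    using assms by (intro summable_on_cmult_right) (simp add: l2_def)
  then show ?thesis
    by (simp add: l2_def spread_def norm_divide power_divide)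
qed

text \<open>Source of the factor \<open>1 / S\<close> in the new frame bounds: \<open>S\<close>
  equal coordinates, each carrying \<open>1 / S^2\<close>.\<close>

lemma l2_norm_spread:
  "(l2_norm \<Lambda> (spread z :: real \<Rightarrow> complex ^ 's))\<^sup>2 = (l2_norm \<Lambda> z)\<^sup>2 / real CARD('s)"
proof -
  have "l2_inner \<Lambda> (spread z :: real \<Rightarrow> complex ^ 's) (spread z)
      = (\<Sum>\<^sub>\<infinity>x\<in>\<Lambda>. 1 / of_nat CARD('s) * (\<Sum>k\<in>UNIV. z x $ k * cnj (z x $ k)))"
    unfolding l2_inner_def by (intro infsum_cong) (simp add: spread_def)
  also have "\<dots> = l2_inner \<Lambda> z z / of_nat CARD('s)"
    \<comment> \<open>The constant can be pulled out unconditionally: if the sum diverges, both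
      sides are 0.\<close>
    unfolding l2_inner_def infsum_cmult_right' by simp
  finally show ?thesis
    by (simp add: l2_norm_def real_sqrt_divide power_divide Re_divide_of_nat)
qed

text \<open>The equality already holds term by term: the factor \<open>1 / S\<close> is real, so
  conjugation fixes it and it can move to the second argument.\<close>

lemma l2_inner_spread:
  fixes Z :: "real \<Rightarrow> complex ^ 's"
  shows "l2_inner \<Lambda> (spread z) Z = l2_inner \<Lambda> z (arith_mean Z)"
  unfolding l2_inner_def
  by (intro infsum_cong) (simp add: spread_def arith_mean_def sum_divide_distrib sum_distrib_left)

text \<open>A modulation multiplies all coordinates by one scalar and a shift moves only the
  argument, so both pass through the average over coordinates.\<close>

lemma dvnug_arith_mean:
  "dvnug N M (\<lambda>j. arith_mean (W j)) i = arith_mean (dvnug N M W i)"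
  by (auto simp: dvnug_def mod_op_def shift_op_def arith_mean_def vec_eq_iff
      sum_distrib_left split: prod.split)

theorem theorem5p1:
  fixes N M P :: nat and r :: int
    and W :: "nat \<Rightarrow> real \<Rightarrow> complex ^ 's"
    and A\<^sub>0 B\<^sub>0 :: real
  assumes "N \<ge> 1" and "M \<ge> 1"
    and "odd r" and "coprime r (int N)" and "1 \<le> r" and "r \<le> 2 * int N - 1"
    and "\<And>j. j \<in> {0..P} \<Longrightarrow> W j \<in> l2 (Lam N r)"
    and "dvnug_frame N r M P W A\<^sub>0 B\<^sub>0"
  shows "(\<forall>j\<in>{0..P}. arith_mean (W j) \<in> l2 (Lam N r)) \<and>
         dvnug_frame N r M P (\<lambda>j. arith_mean (W j)) (A\<^sub>0 / real CARD('s)) (B\<^sub>0 / real CARD('s))"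
proof (intro conjI ballI)
  fix j assume "j \<in> {0..P}"
  then show "arith_mean (W j) \<in> l2 (Lam N r)"
    by (intro arith_mean_in_l2 assms)
next
  let ?\<Lambda> = "Lam N r"
  let ?I = "{0..<M} \<times> {0..P} \<times> ?\<Lambda>"
  have bounds: "0 < A\<^sub>0" "A\<^sub>0 \<le> B\<^sub>0"
    and frame: "\<And>Z. Z \<in> l2 ?\<Lambda> \<Longrightarrow>
         (\<lambda>i. (cmod (l2_inner ?\<Lambda> Z (dvnug N M W i)))\<^sup>2) summable_on ?I \<and>
         A\<^sub>0 * (l2_norm ?\<Lambda> Z)\<^sup>2 \<le> (\<Sum>\<^sub>\<infinity>i\<in>?I. (cmod (l2_inner ?\<Lambda> Z (dvnug N M W i)))\<^sup>2) \<and>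
         (\<Sum>\<^sub>\<infinity>i\<in>?I. (cmod (l2_inner ?\<Lambda> Z (dvnug N M W i)))\<^sup>2) \<le> B\<^sub>0 * (l2_norm ?\<Lambda> Z)\<^sup>2"
    using assms(8) by (simp_all add: dvnug_frame_def Let_def)
  show "dvnug_frame N r M P (\<lambda>j. arith_mean (W j)) (A\<^sub>0 / real CARD('s)) (B\<^sub>0 / real CARD('s))"
    unfolding dvnug_frame_def Let_def dvnug_arith_mean
  proof (intro conjI ballI)
    show "0 < A\<^sub>0 / real CARD('s)" "A\<^sub>0 / real CARD('s) \<le> B\<^sub>0 / real CARD('s)"
      using bounds by (simp_all add: divide_right_mono)
  \<comment> \<open>At \<open>Z = spread z\<close> the coefficients become those of \<open>z\<close>
    against the averaged windows, and the \<open>1 / S\<close> from the squared norm is absorbed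
    into \<open>A\<^sub>0\<close> and \<open>B\<^sub>0\<close>.\<close>
  qed (use frame[OF spread_in_l2] in \<open>simp_all add: l2_inner_spread l2_norm_spread\<close>)
qed

end
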